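(* Let $\mathcal{M}_1,\dots,\mathcal{M}_m$ be $n$-outcome quantum measurements on a finite-dimensional Hilbert space $\mathcal{H}_d$. If they can be perfectly discriminated (in a single use, with ancilla-assisted tests allowed), then $m\le n$.
   Context: An $n$-outcome measurement $\mathcal{M}_l$ on the $d$-dimensional complex Hilbert space $\mathcal{H}_d$ is a POVM $\{M_{lj}\}_{j=1}^n$: $M_{lj}\ge 0$, $\sum_j M_{lj}=I$. A (single-shot, general ancilla-assisted) test $\mathcal{T}$ with conclusions $c\in\{1,\dots,m\}$ is a family of positive semidefinite operators $H^{(c)}_j$ on $\mathcal{H}_d$, $j=1,\dots,n$, such that $\sum_{c} H^{(c)}_j=\rho$ for every $j$, where $\rho\ge0$, $\mathrm{tr}[\rho]=1$ is independent of $j$. The probability of conclusion $c$ when the tested measurement is $\mathcal{M}_l$ is $p(c|\mathcal{M}_l,\mathcal{T})=\sum_j \mathrm{tr}[H^{(c)}_jM_{lj}]$. The measurements $\mathcal{M}_1,\dots,\mathcal{M}_m$ can be perfectly discriminated if there is a test $\mathcal{T}$ with $p(c|\mathcal{M}_l,\mathcal{T})=\delta_{cl}$ for all $c,l\in\{1,\dots,m\}$. *)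

theory Defs
  imports "HOL-Analysis.Analysis" "HOL-Library.Complex_Order"
begin

text \<open>
  The Hilbert space of dimension \<open>d = CARD('d)\<close> is \<^typ>\<open>complex ^ 'd\<close>, and operators on it are
  square complex matrices.  The inner product of the library on this type is the real one,
  so the Hermitian form is defined here.
\<close>

definition hermitian_form :: "complex ^ 'd \<Rightarrow> complex ^ 'd \<Rightarrow> complex" where
  "hermitian_form v w = (\<Sum>i\<in>UNIV. cnj (v $ i) * w $ i)"

text \<open>
  With the order of \<^theory>\<open>HOL-Library.Complex_Order\<close>, \<open>0 \<le> z\<close> says that \<open>z\<close> is real and
  nonnegative; over the complex numbers this forces a positive operator to be Hermitian.
\<close>

definition positive_op :: "complex ^ 'd ^ 'd \<Rightarrow> bool" where
  "positive_op A \<longleftrightarrow> (\<forall>v. 0 \<le> hermitian_form v (A *v v))"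

definition density_op :: "complex ^ 'd ^ 'd \<Rightarrow> bool" where
  "density_op \<rho> \<longleftrightarrow> positive_op \<rho> \<and> trace \<rho> = 1"

definition povm :: "nat \<Rightarrow> (nat \<Rightarrow> complex ^ 'd ^ 'd) \<Rightarrow> bool" where
  "povm n M \<longleftrightarrow> (\<forall>j\<in>{1..n}. positive_op (M j)) \<and> (\<Sum>j=1..n. M j) = mat 1"

text \<open>
  A single-shot ancilla-assisted test with conclusions \<open>1, \<dots>, m\<close> for \<open>n\<close>-outcome measurements:
  \<open>H c j\<close> is the operator attached to conclusion \<open>c\<close> and measurement outcome \<open>j\<close>.
\<close>

definition is_test :: "nat \<Rightarrow> nat \<Rightarrow> (nat \<Rightarrow> nat \<Rightarrow> complex ^ 'd ^ 'd) \<Rightarrow> bool" where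
  "is_test m n H \<longleftrightarrow>
     (\<forall>c\<in>{1..m}. \<forall>j\<in>{1..n}. positive_op (H c j)) \<and>
     (\<exists>\<rho>. density_op \<rho> \<and> (\<forall>j\<in>{1..n}. (\<Sum>c=1..m. H c j) = \<rho>))"

text \<open>Complex-valued, like the trace; the value is real for a test and a measurement.\<close>

definition conclusion_prob ::
  "nat \<Rightarrow> (nat \<Rightarrow> nat \<Rightarrow> complex ^ 'd ^ 'd) \<Rightarrow> nat \<Rightarrow> (nat \<Rightarrow> complex ^ 'd ^ 'd) \<Rightarrow> complex" where
  "conclusion_prob n H c M = (\<Sum>j=1..n. trace (H c j ** M j))"

definition perfectly_discriminable ::
  "nat \<Rightarrow> nat \<Rightarrow> (nat \<Rightarrow> nat \<Rightarrow> complex ^ 'd ^ 'd) \<Rightarrow> bool" where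
  "perfectly_discriminable m n M \<longleftrightarrow>
     (\<exists>H. is_test m n H \<and>
        (\<forall>c\<in>{1..m}. \<forall>l\<in>{1..m}. conclusion_prob n H c (M l) = (if c = l then 1 else 0)))"

end

theory Submission imports Defs begin

text \<open>
  Since \<open>M\<^sub>l\<^sub>j \<le> I\<close>, each success probability \<open>1 = (\<Sum>j. tr (H\<^sup>l\<^sub>j M\<^sub>l\<^sub>j))\<close> is at most
  \<open>\<Sum>j. tr H\<^sup>l\<^sub>j\<close>. Summing over \<open>l\<close> gives \<open>m \<le> (\<Sum>j. tr \<rho>) = n\<close>. The fact that the trace of a
  product of two positive operators is nonnegative is obtained by Cholesky elimination: subtracting
  a suitable rank-one operator from a positive operator clears one row and column and leaves a
  positive operator.
\<close>

section \<open>Sesquilinear algebra of the form\<close>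

lemma hermitian_form_add_left: "hermitian_form (u + v) w = hermitian_form u w + hermitian_form v w"
  by (simp add: hermitian_form_def algebra_simps sum.distrib)

lemma hermitian_form_add_right: "hermitian_form u (v + w) = hermitian_form u v + hermitian_form u w"
  by (simp add: hermitian_form_def algebra_simps sum.distrib)

lemma hermitian_form_scale_left: "hermitian_form (c *s v) w = cnj c * hermitian_form v w"
  by (simp add: hermitian_form_def sum_distrib_left algebra_simps)

lemma hermitian_form_scale_right: "hermitian_form v (c *s w) = c * hermitian_form v w"
  by (simp add: hermitian_form_def sum_distrib_left algebra_simps)

lemma hermitian_form_diff_right: "hermitian_form u (v - w) = hermitian_form u v - hermitian_form u w"
  by (simp add: hermitian_form_def algebra_simps sum_subtractf)

lemma hermitian_form_axis_left: "hermitian_form (axis k 1) w = w $ k"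
proof -
  have "hermitian_form (axis k 1) w = (\<Sum>i\<in>UNIV. if i = k then w $ i else 0)"
    unfolding hermitian_form_def by (rule sum.cong) (auto simp: axis_def)
  then show ?thesis by simp
qed

lemma matrix_vector_mult_axis: "A *v axis k 1 = column k A"
  for A :: "'a::semiring_1 ^ 'm ^ 'n"
proof -
  have "(A *v axis k 1) $ i = (\<Sum>j\<in>UNIV. if j = k then A $ i $ j else 0)" for i
    unfolding matrix_vector_mult_def vec_lambda_beta
    by (rule sum.cong) (auto simp: axis_def)
  then show ?thesis by (simp add: vec_eq_iff column_def)
qed

text \<open>Serves both polarization, with \<open>c\<close> equal to 1 or \<i>, and the quadratic
  estimate behind Cauchy-Schwarz.\<close>

lemma hermitian_form_expand:
  "hermitian_form (x + c *s y) (A *v (x + c *s y)) =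
     hermitian_form x (A *v x) + c * hermitian_form x (A *v y)
     + cnj c * hermitian_form y (A *v x) + cnj c * c * hermitian_form y (A *v y)"
  by (simp add: matrix_vector_right_distrib vector_scalar_commute hermitian_form_add_left
      hermitian_form_add_right hermitian_form_scale_left hermitian_form_scale_right algebra_simps)

section \<open>Hermitian symmetry and Cauchy-Schwarz for positive operators\<close>

lemma positive_op_hermitian:
  assumes "positive_op A"
  shows "hermitian_form y (A *v x) = cnj (hermitian_form x (A *v y))"
proof -
  have nn: "0 \<le> hermitian_form v (A *v v)" for v
    using assms by (simp add: positive_op_def)
  then have im: "Im (hermitian_form v (A *v v)) = 0" for v
    by (metis less_eq_complex_def zero_complex.sel(2))
  \<comment> \<open>Polarization: the form is real at \<open>x + y\<close>, which makes the
    imaginary parts of the two cross terms opposite; its reality at \<open>x + \<i> *s y\<close>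
    then makes their real parts equal.\<close>
  have "Im (hermitian_form x (A *v y)) + Im (hermitian_form y (A *v x)) = 0"
    using im[of "x + 1 *s y"] im[of x] im[of y] unfolding hermitian_form_expand by simp
  moreover have "Re (hermitian_form x (A *v y)) - Re (hermitian_form y (A *v x)) = 0"
    using im[of "x + \<i> *s y"] im[of x] im[of y] unfolding hermitian_form_expand by simp
  ultimately show ?thesis
    by (simp add: complex_eq_iff)
qed

lemma positive_op_Cauchy_Schwarz:
  assumes "positive_op A"
  shows "(cmod (hermitian_form x (A *v y)))\<^sup>2
    \<le> Re (hermitian_form x (A *v x)) * Re (hermitian_form y (A *v y))"
proof -
  define a where "a = Re (hermitian_form y (A *v y))"
  define z where "z = hermitian_form x (A *v y)"
  define b where "b = Re (hermitian_form x (A *v x))"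
  have nn: "0 \<le> hermitian_form v (A *v v)" for v
    using assms by (simp add: positive_op_def)
  have "a \<ge> 0"
    using nn[of y] by (simp add: a_def less_eq_complex_def)
  have ya: "hermitian_form y (A *v y) = of_real a"
    using nn[of y] by (simp add: a_def less_eq_complex_def complex_eq_iff)
  have yx: "hermitian_form y (A *v x) = cnj z"
    unfolding z_def by (rule positive_op_hermitian[OF assms])
  have key: "0 \<le> b - 2 * t * (cmod z)\<^sup>2 + t\<^sup>2 * (cmod z)\<^sup>2 * a" for t
  proof -
    \<comment> \<open>The factor \<open>cnj z\<close> cancels the phase of the cross terms, so that
      only a real quadratic in \<open>t\<close> remains.\<close>
    define c where "c = - (of_real t * cnj z)"
    have "0 \<le> Re (hermitian_form (x + c *s y) (A *v (x + c *s y)))"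
      using nn[of "x + c *s y"] unfolding less_eq_complex_def by simp
    also have "\<dots> = b - 2 * t * (cmod z)\<^sup>2 + t\<^sup>2 * (cmod z)\<^sup>2 * a"
      unfolding hermitian_form_expand ya yx z_def[symmetric]
      by (simp add: c_def b_def cmod_def power2_eq_square algebra_simps)
    finally show ?thesis .
  qed
  have "(cmod z)\<^sup>2 \<le> b * a"
  proof (cases "a = 0")
    case True
    have "cmod z = 0"
    proof (rule ccontr)
      \<comment> \<open>For \<open>a = 0\<close> the bound is affine in \<open>t\<close> with
        negative slope; the chosen \<open>t\<close> makes it equal to -1.\<close>
      assume "cmod z \<noteq> 0"
      then show False
        using key[of "(b + 1) / (2 * (cmod z)\<^sup>2)"] True by simp
    qed
    then show ?thesis using True by simp
  next
    case False
    \<comment> \<open>The quadratic in \<open>t\<close> is smallest at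
      \<open>t = 1 / a\<close>.\<close>
    then have "0 \<le> b - (cmod z)\<^sup>2 / a"
      using key[of "1 / a"] by (simp add: field_simps power2_eq_square)
    then show ?thesis
      using False \<open>a \<ge> 0\<close> by (simp add: field_simps)
  qed
  then show ?thesis by (simp add: a_def b_def z_def)
qed

lemma matrix_axis_entry: "hermitian_form (axis i 1) (A *v axis j 1) = A $ i $ j"
  for A :: "complex ^ 'd ^ 'd"
  by (simp add: hermitian_form_axis_left matrix_vector_mult_axis column_def)

lemma positive_op_entry_cnj:
  "positive_op A \<Longrightarrow> A $ j $ i = cnj (A $ i $ j)"
  using positive_op_hermitian[of A "axis j 1" "axis i 1"] by (simp add: matrix_axis_entry)

text \<open>Cauchy-Schwarz on basis vectors bounds the squared modulus of the entry by the product
  of two diagonal entries, one of which is 0.\<close>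

lemma positive_op_entry_eq_0:
  assumes "positive_op A" "A $ k $ k = 0"
  shows "A $ i $ k = 0"
  using positive_op_Cauchy_Schwarz[OF assms(1), of "axis i 1" "axis k 1"] assms(2)
  by (simp add: matrix_axis_entry)

section \<open>Schur complements and the trace of a product of positive operators\<close>

definition schur_complement :: "'d \<Rightarrow> complex ^ 'd ^ 'd \<Rightarrow> complex ^ 'd ^ 'd" where
  "schur_complement k A = (\<chi> i j. A $ i $ j - A $ i $ k * A $ k $ j / A $ k $ k)"

text \<open>If \<open>A $ k $ k = 0\<close>, then nothing is subtracted, but row and column \<open>k\<close> of \<open>A\<close> already vanish.\<close>

lemma schur_complement_entry_eq_0:
  assumes "positive_op A" "i = k \<or> j = k"
  shows "schur_complement k A $ i $ j = 0"
proof (cases "A $ k $ k = 0")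
  case True
  then have "A $ l $ k = 0" "A $ k $ l = 0" for l
    using positive_op_entry_eq_0[OF assms(1) True, of l] positive_op_entry_cnj[OF assms(1), of k l]
    by simp_all
  with assms(2) show ?thesis by (auto simp: schur_complement_def)
next
  case False
  with assms(2) show ?thesis by (auto simp: schur_complement_def)
qed

text \<open>The elimination lowers the quadratic form at \<open>w\<close> by the squared modulus of
  the pairing of \<open>w\<close> with column \<open>k\<close>, divided by the pivot. Cauchy-Schwarz
  against the basis vector \<open>axis k 1\<close> says that this loss is at most the original
  value.\<close>

lemma positive_op_schur_complement:
  assumes "positive_op A"
  shows "positive_op (schur_complement k A)"
  unfolding positive_op_def
proof
  fix w :: "complex ^ 'a"
  let ?r = "A *v axis k 1"
  define z where "z = hermitian_form w ?r"
  define b where "b = Re (hermitian_form w (A *v w))"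
  define a where "a = Re (A $ k $ k)"
  have nn: "0 \<le> hermitian_form v (A *v v)" for v
    using assms by (simp add: positive_op_def)
  have akk: "A $ k $ k = of_real a" "a \<ge> 0"
    using nn[of "axis k 1"] by (simp_all add: matrix_axis_entry a_def less_eq_complex_def complex_eq_iff)
  have wb: "hermitian_form w (A *v w) = of_real b"
    using nn[of w] by (simp add: b_def less_eq_complex_def complex_eq_iff)
  have "schur_complement k A *v w = A *v w - ((A *v w) $ k / A $ k $ k) *s ?r"
    unfolding matrix_vector_mult_axis
    by (simp add: schur_complement_def vec_eq_iff column_def
        matrix_vector_mult_def right_diff_distrib left_diff_distrib sum_subtractf
        sum_distrib_left sum_distrib_right sum_divide_distrib mult_ac)
  moreover have "(A *v w) $ k = cnj z"
    using positive_op_hermitian[OF assms, of "axis k 1" w]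
    by (simp add: z_def hermitian_form_axis_left)
  ultimately have "hermitian_form w (schur_complement k A *v w) = of_real b - cnj z * z / of_real a"
    by (simp add: hermitian_form_diff_right hermitian_form_scale_right wb akk z_def)
  also have "\<dots> = of_real (b - (cmod z)\<^sup>2 / a)"
    by (simp add: complex_norm_square mult.commute del: of_real_power)
  finally have eq: "hermitian_form w (schur_complement k A *v w) = of_real (b - (cmod z)\<^sup>2 / a)" .
  have "b \<ge> 0"
    using nn[of w] by (simp add: b_def less_eq_complex_def)
  moreover have "(cmod z)\<^sup>2 \<le> b * a"
    using positive_op_Cauchy_Schwarz[OF assms, of w "axis k 1"]
    by (simp add: z_def b_def matrix_axis_entry a_def)
  \<comment> \<open>For \<open>a = 0\<close> the quotient is 0 by convention, and
    \<open>b \<ge> 0\<close> suffices.\<close>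
  ultimately have "0 \<le> b - (cmod z)\<^sup>2 / a"
    using \<open>a \<ge> 0\<close> by (cases "a = 0") (simp_all add: field_simps)
  then show "0 \<le> hermitian_form w (schur_complement k A *v w)"
    unfolding eq by (simp add: less_eq_complex_def)
qed

text \<open>The subtracted rank-one operator is column \<open>k\<close> times its adjoint over the
  pivot, because row \<open>k\<close> is the conjugate of column \<open>k\<close>. Its trace against
  \<open>B\<close> is a value of the quadratic form of \<open>B\<close>.\<close>

lemma trace_schur_complement:
  assumes "positive_op A"
  shows "trace (A ** B) = trace (schur_complement k A ** B)
    + hermitian_form (column k A) (B *v column k A) / A $ k $ k"
proof -
  have "hermitian_form (column k A) (B *v column k A) / A $ k $ k
      = (\<Sum>i\<in>UNIV. \<Sum>j\<in>UNIV. A $ k $ i * (B $ i $ j * A $ j $ k) / A $ k $ k)"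
    by (simp add: positive_op_entry_cnj[OF assms, of k, symmetric] hermitian_form_def
        matrix_vector_mult_def column_def sum_distrib_left sum_divide_distrib)
  also have "\<dots> = (\<Sum>j\<in>UNIV. \<Sum>i\<in>UNIV. A $ k $ i * (B $ i $ j * A $ j $ k) / A $ k $ k)"
    by (rule sum.swap)
  finally show ?thesis
    by (simp add: trace_def matrix_matrix_mult_def schur_complement_def left_diff_distrib
        right_diff_distrib sum_subtractf mult_ac)
qed

lemma trace_mult_positive_op_nonneg:
  fixes A B :: "complex ^ 'd ^ 'd"
  assumes "positive_op A" "positive_op B"
  shows "0 \<le> trace (A ** B)"
proof -
  \<comment> \<open>Generalized to an index set \<open>S\<close> supporting the entries of
    \<open>A\<close>, so that each elimination removes one index from \<open>S\<close>.\<close>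
  have "0 \<le> trace (A ** B)"
    if "finite S" "positive_op A" "\<And>i j. i \<notin> S \<or> j \<notin> S \<Longrightarrow> A $ i $ j = 0"
    for S and A :: "complex ^ 'd ^ 'd"
    using that
  proof (induction S arbitrary: A)
    case empty
    then have "A = 0" by (simp add: vec_eq_iff)
    then show ?case by (simp add: trace_def)
  next
    case (insert k S)
    have "0 \<le> trace (schur_complement k A ** B)"
    proof (rule insert.IH)
      show "positive_op (schur_complement k A)"
        using insert.prems(1) by (rule positive_op_schur_complement)
    next
      fix i j assume ij: "i \<notin> S \<or> j \<notin> S"
      show "schur_complement k A $ i $ j = 0"
      proof (cases "i = k \<or> j = k")
        case True
        with insert.prems(1) show ?thesis by (rule schur_complement_entry_eq_0)
      next
        case False
        with ij have "i \<notin> insert k S \<or> j \<notin> insert k S" by blast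
        \<comment> \<open>The subtracted product vanishes too, since its factor in row
          \<open>i\<close> or its factor in column \<open>j\<close> lies outside the
          support.\<close>
        then show ?thesis
          using insert.prems(2) unfolding schur_complement_def by auto
      qed
    qed
    moreover have "0 \<le> hermitian_form (column k A) (B *v column k A) / A $ k $ k"
    proof -
      have "0 \<le> hermitian_form (column k A) (B *v column k A)"
        using assms(2) by (simp add: positive_op_def)
      moreover have "0 \<le> A $ k $ k"
        using insert.prems(1) by (metis matrix_axis_entry positive_op_def)
      \<comment> \<open>A zero pivot is harmless here: the quotient is then 0.\<close>
      ultimately show ?thesis
        by (auto simp: less_eq_complex_def Re_divide Im_divide)
    qed
    ultimately show ?case
      by (simp add: trace_schur_complement[OF insert.prems(1), of B k])
  qed
  from this[of UNIV A] assms(1) show ?thesis by simp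
qed

section \<open>Measurement bounds and the count of conclusions\<close>

lemma positive_op_sum:
  assumes "\<And>i. i \<in> I \<Longrightarrow> positive_op (A i)"
  shows "positive_op (\<Sum>i\<in>I. A i)"
  using assms
proof (induction I rule: infinite_finite_induct)
  case (insert i I)
  then show ?case
    by (simp add: positive_op_def matrix_vector_mult_add_rdistrib hermitian_form_add_right)
qed (simp_all add: positive_op_def hermitian_form_def)

lemma matrix_mult_diff_distrib: "A ** (B - C) = A ** B - A ** C"
  for A :: "'a::ring_1 ^ 'm ^ 'n"
  by (simp add: matrix_matrix_mult_def vec_eq_iff right_diff_distrib sum_subtractf)

text \<open>The difference \<open>mat 1 - M j\<close> is the sum of the remaining effects, hence
  positive, and so has nonnegative trace against \<open>A\<close>.\<close>

lemma trace_mult_povm_le: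
  assumes "povm n M" "j \<in> {1..n}" "positive_op A"
  shows "trace (A ** M j) \<le> trace A"
proof -
  have "mat 1 - M j = (\<Sum>i\<in>{1..n} - {j}. M i)"
    using assms(1,2) by (simp add: povm_def sum_diff1)
  moreover have "positive_op (\<Sum>i\<in>{1..n} - {j}. M i)"
    using assms(1) by (intro positive_op_sum) (simp add: povm_def)
  ultimately have "0 \<le> trace (A ** (mat 1 - M j))"
    using trace_mult_positive_op_nonneg[OF assms(3)] by simp
  also have "A ** (mat 1 - M j) = A - A ** M j"
    by (simp add: matrix_mult_diff_distrib)
  finally show ?thesis
    by (simp add: trace_sub)
qed

lemma trace_sum: "trace (\<Sum>i\<in>I. A i) = (\<Sum>i\<in>I. trace (A i))"
  for A :: "'i \<Rightarrow> complex ^ 'd ^ 'd"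
  by (induction I rule: infinite_finite_induct) (simp_all add: trace_add trace_0[unfolded mat_0])

theorem proposition1:
  fixes M :: "nat \<Rightarrow> nat \<Rightarrow> complex ^ 'd ^ 'd" and m n :: nat
  assumes "\<And>l. l \<in> {1..m} \<Longrightarrow> povm n (M l)"
    and "perfectly_discriminable m n M"
  shows "m \<le> n"
proof -
  from assms(2) obtain H where test: "is_test m n H"
    and H: "\<forall>c\<in>{1..m}. \<forall>l\<in>{1..m}. conclusion_prob n H c (M l) = (if c = l then 1 else 0)"
    unfolding perfectly_discriminable_def by blast
  from H have prob: "\<And>c. c \<in> {1..m} \<Longrightarrow> conclusion_prob n H c (M c) = 1"
    by simp
  from test have pos: "\<And>c j. c \<in> {1..m} \<Longrightarrow> j \<in> {1..n} \<Longrightarrow> positive_op (H c j)"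
    unfolding is_test_def by blast
  from test obtain \<rho> where sum_H: "\<And>j. j \<in> {1..n} \<Longrightarrow> (\<Sum>c=1..m. H c j) = \<rho>" and "trace \<rho> = 1"
    unfolding is_test_def density_op_def by blast
  have "of_nat m = (\<Sum>c=1..m. conclusion_prob n H c (M c))"
    by (simp add: prob)
  also have "\<dots> \<le> (\<Sum>c=1..m. \<Sum>j=1..n. trace (H c j))"
    unfolding conclusion_prob_def
    by (intro sum_mono trace_mult_povm_le[where n = n] assms(1) pos)
  \<comment> \<open>With the outcome outermost, the operators of all conclusions add up to
    \<open>\<rho>\<close>, and each outcome contributes trace 1.\<close>
  also have "\<dots> = (\<Sum>j=1..n. trace (\<Sum>c=1..m. H c j))"
    unfolding trace_sum by (rule sum.swap)
  also have "\<dots> = of_nat n"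
    using sum_H \<open>trace \<rho> = 1\<close> by simp
  finally show "m \<le> n"
    by (simp add: less_eq_complex_def)
qed

end
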